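(* Let $\varphi:\mathbb{R}\to(0,\infty)$ be self-neglecting. Let $f:\mathbb{R}\to(0,\infty)$ have the Baire property (respectively, be Lebesgue measurable) and suppose that there is a function $g$ such that for every $t\in\mathbb{R}$ $$\frac{f(x+t\varphi(x))}{f(x)}\to g(t)\quad\text{as }x\to\infty,$$ where $g$ is strictly positive on a non-negligible set. Then this convergence is locally uniform in $t$, i.e. uniform for $t$ in compact subsets of $\mathbb{R}$.
   Context: A function $\varphi:\mathbb{R}\to(0,\infty)$ is self-neglecting, written $\varphi\in SN$, if $\varphi(x+t\varphi(x))/\varphi(x)\to 1$ as $x\to\infty$, locally uniformly in $t\in\mathbb{R}$ (no measurability or Baire property is included in this definition). "Negligible" means meagre when $f$ has the Baire property, and Lebesgue null when $f$ is measurable. *)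

theory Defs
  imports "HOL-Analysis.Analysis"
begin

definition nowhere_dense :: "'a::topological_space set \<Rightarrow> bool" where
  "nowhere_dense A \<longleftrightarrow> interior (closure A) = {}"

definition meagre :: "'a::topological_space set \<Rightarrow> bool" where
  "meagre A \<longleftrightarrow> (\<exists>N :: nat \<Rightarrow> 'a set. (\<forall>n. nowhere_dense (N n)) \<and> A = (\<Union>n. N n))"

definition baire_property_set :: "'a::topological_space set \<Rightarrow> bool" where
  "baire_property_set A \<longleftrightarrow> (\<exists>U. open U \<and> meagre ((A - U) \<union> (U - A)))"

definition baire_property_fun ::
    "('a::topological_space \<Rightarrow> 'b::topological_space) \<Rightarrow> bool" where
  "baire_property_fun f \<longleftrightarrow> (\<forall>V. open V \<longrightarrow> baire_property_set (f -` V))"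

text \<open>As in \<^const>\<open>uniform_limit\<close>, the first argument of \<open>h\<close> runs along the filter and
  the second one is the variable in which convergence is uniform.\<close>

definition locally_uniform_limit ::
    "('x \<Rightarrow> 'a::topological_space \<Rightarrow> 'b::metric_space) \<Rightarrow> ('a \<Rightarrow> 'b) \<Rightarrow> 'x filter \<Rightarrow> bool" where
  "locally_uniform_limit h l F \<longleftrightarrow> (\<forall>K. compact K \<longrightarrow> uniform_limit K h l F)"

definition self_neglecting :: "(real \<Rightarrow> real) \<Rightarrow> bool" where
  "self_neglecting \<phi> \<longleftrightarrow> (\<forall>x. 0 < \<phi> x) \<and>
     locally_uniform_limit (\<lambda>x t. \<phi> (x + t * \<phi> x) / \<phi> x) (\<lambda>t. 1) at_top"

end

theory Submission
  imports Defs
begin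

text \<open>
  Let \<open>x\<^sub>n \<rightarrow> \<infinity>\<close>, \<open>u\<^sub>n \<rightarrow> 0\<close> and \<open>y\<^sub>n = x\<^sub>n + u\<^sub>n \<phi>(x\<^sub>n)\<close>. The set \<open>{g > 0}\<close> is a countable union of
  sets \<open>E\<close> on which \<open>ln g\<close> is nearly constant and on which the logarithmic convergence along both
  \<open>x\<^sub>n\<close> and \<open>y\<^sub>n\<close> is uniform up to \<open>\<epsilon>\<close> from some index on; one of them is non-negligible. A point
  \<open>x\<^sub>n + t \<phi>(x\<^sub>n)\<close> equals \<open>y\<^sub>n + s \<phi>(y\<^sub>n)\<close> with \<open>s = c\<^sub>n (t - u\<^sub>n)\<close> and \<open>c\<^sub>n = \<phi>(x\<^sub>n) / \<phi>(y\<^sub>n) \<rightarrow> 1\<close>, so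
  a Steinhaus argument for these affine maps provides such \<open>s\<close> and \<open>t\<close> in the same \<open>E\<close>, whence
  \<open>f(y\<^sub>n) / f(x\<^sub>n) \<rightarrow> 1\<close>. Shifting the base point extends this to \<open>u\<^sub>n \<rightarrow> u\<close> for every \<open>u\<close>, and
  continuous convergence is locally uniform convergence.
\<close>

section \<open>Continuous convergence\<close>

text \<open>If uniformity fails on \<open>K\<close>, there are bad points \<open>x n\<close> and
  \<open>t n\<close> with a gap \<open>e\<close>. A subsequence of \<open>t\<close> converges by
  compactness, and continuous convergence at its limit closes the gap.\<close>

lemma locally_uniform_limit_sequentiallyI:
  fixes F :: "real \<Rightarrow> real \<Rightarrow> real"
  assumes cc: "\<And>x u l. filterlim x at_top sequentially \<Longrightarrow> u \<longlonglongrightarrow> l \<Longrightarrow>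
                 (\<lambda>n. F (x n) (u n)) \<longlonglongrightarrow> g l"
  shows "locally_uniform_limit F g at_top"
  unfolding locally_uniform_limit_def
proof (intro allI impI)
  fix K :: "real set"
  assume K: "compact K"
  show "uniform_limit K F g at_top"
  proof (rule ccontr)
    assume "\<not> uniform_limit K F g at_top"
    then obtain e where e: "e > 0" "\<not> (\<forall>\<^sub>F x in at_top. \<forall>t\<in>K. dist (F x t) (g t) < e)"
      unfolding uniform_limit_iff by auto
    then have "\<exists>x t. x \<ge> real n \<and> t \<in> K \<and> dist (F x t) (g t) \<ge> e" for n :: nat
      unfolding eventually_at_top_linorder by (meson linorder_not_less)
    then obtain x t where xt: "\<And>n. x n \<ge> real n" "\<And>n. t n \<in> K"
      "\<And>n. dist (F (x n) (t n)) (g (t n)) \<ge> e"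
      by metis
    have pointwise: "(\<lambda>n. F (real n) l) \<longlonglongrightarrow> g l" for l
      by (rule cc) (auto intro: filterlim_real_sequentially)
    have "\<exists>m\<ge>n. dist (F (real m) (t n)) (g (t n)) < e / 2" for n :: nat
      using tendstoD[OF pointwise[of "t n"], of "e / 2"] e
      unfolding eventually_sequentially by (meson half_gt_zero nle_le)
    then obtain m where m: "\<And>n. m n \<ge> n" "\<And>n. dist (F (real (m n)) (t n)) (g (t n)) < e / 2"
      by metis
    obtain l r where r: "strict_mono r" "(t \<circ> r) \<longlonglongrightarrow> l"
      using K xt(2) unfolding compact_def by metis
    have lim: "filterlim (\<lambda>n. z (r n)) at_top sequentially"
      if "\<And>n. z n \<ge> real n" for z :: "nat \<Rightarrow> real"
    proof (rule filterlim_at_top_mono[OF filterlim_real_sequentially])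
      show "\<forall>\<^sub>F n in sequentially. real n \<le> z (r n)"
        using that seq_suble[OF r(1)] by (intro always_eventually allI) (meson of_nat_mono order_trans)
    qed
    have t: "(\<lambda>n. t (r n)) \<longlonglongrightarrow> l"
      using r(2) by (simp add: o_def)
    have "(\<lambda>n. dist (F (x (r n)) (t (r n))) (F (real (m (r n))) (t (r n)))) \<longlonglongrightarrow> dist (g l) (g l)"
      using xt(1) m(1) by (intro tendsto_dist cc t lim) auto
    then have "\<forall>\<^sub>F n in sequentially.
        dist (F (x (r n)) (t (r n))) (F (real (m (r n))) (t (r n))) < e / 2"
      using e by (intro order_tendstoD) auto
    then obtain n where "dist (F (x (r n)) (t (r n))) (F (real (m (r n))) (t (r n))) < e / 2"
      unfolding eventually_sequentially by blast
    with m(2)[of "r n"] xt(3)[of "r n"] show False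
      using dist_triangle[of "F (x (r n)) (t (r n))" "g (t (r n))" "F (real (m (r n))) (t (r n))"]
      by linarith
  qed
qed

section \<open>Self-neglecting functions\<close>

lemma self_neglecting_pos: "self_neglecting \<phi> \<Longrightarrow> 0 < \<phi> x"
  by (simp add: self_neglecting_def)

lemma self_neglecting_eventually:
  assumes "self_neglecting \<phi>" "e > 0"
  shows "\<forall>\<^sub>F x in at_top. \<forall>t. \<bar>t\<bar> \<le> C \<longrightarrow> \<bar>\<phi> (x + t * \<phi> x) / \<phi> x - 1\<bar> < e"
proof -
  have "uniform_limit {-C..C} (\<lambda>x t. \<phi> (x + t * \<phi> x) / \<phi> x) (\<lambda>t. 1) at_top"
    using assms by (auto simp: self_neglecting_def locally_uniform_limit_def)
  from uniform_limitD[OF this assms(2)] show ?thesis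
    by eventually_elim (auto simp: dist_real_def abs_le_iff)
qed

text \<open>If \<open>x - C \<phi>(x) \<le> B\<close>, then \<open>B\<close> is within reach of \<open>x\<close>, so that \<open>\<phi>(x)\<close> is comparable to \<open>\<phi>(B)\<close>;
  this bounds \<open>x\<close>.\<close>

lemma self_neglecting_minus_at_top:
  assumes sn: "self_neglecting \<phi>" and "C > 0"
  shows "filterlim (\<lambda>x. x - C * \<phi> x) at_top at_top"
  unfolding filterlim_at_top_dense
proof
  fix B :: real
  \<comment> \<open>A failure at \<open>x\<close> will give
    \<open>x \<le> B + C * \<phi> x < B + 2 * C * \<phi> B\<close>, which this threshold excludes.
    The bound \<open>B\<close> makes the shift \<open>t\<close> below negative.\<close>
  have "\<forall>\<^sub>F x in at_top. x > max B (B + 2 * C * \<phi> B)"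
    by (rule eventually_gt_at_top)
  moreover have "\<forall>\<^sub>F x in at_top. \<forall>t. \<bar>t\<bar> \<le> C \<longrightarrow> \<bar>\<phi> (x + t * \<phi> x) / \<phi> x - 1\<bar> < 1/2"
    by (rule self_neglecting_eventually[OF sn]) simp
  ultimately show "\<forall>\<^sub>F x in at_top. B < x - C * \<phi> x"
  proof eventually_elim
    case (elim x)
    show ?case
    proof (rule ccontr)
      assume "\<not> B < x - C * \<phi> x"
      then have B: "x - B \<le> C * \<phi> x" by simp
      have pos: "\<phi> x > 0" by (rule self_neglecting_pos[OF sn])
      define t where "t = (B - x) / \<phi> x"
      have "\<bar>t\<bar> \<le> C"
        using B elim(1) pos by (simp add: t_def abs_if field_simps)
      moreover have "x + t * \<phi> x = B"
        using pos by (simp add: t_def)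
      ultimately have "\<bar>\<phi> B / \<phi> x - 1\<bar> < 1/2"
        using elim(2) by metis
      then have "\<phi> B / \<phi> x > 1/2" by linarith
      then have "\<phi> x < 2 * \<phi> B"
        using pos by (simp add: field_simps)
      then have "C * \<phi> x < C * (2 * \<phi> B)"
        using \<open>C > 0\<close> by (rule mult_strict_left_mono)
      with B elim(1) show False by simp
    qed
  qed
qed

text \<open>A convergent \<open>u\<close> is bounded by some \<open>C\<close>, so the shift by
  \<open>- C\<close> is the worst case.\<close>

lemma self_neglecting_shift_at_top:
  assumes sn: "self_neglecting \<phi>"
    and x: "filterlim x at_top sequentially" and u: "u \<longlonglongrightarrow> (l :: real)"
  shows "filterlim (\<lambda>n. x n + u n * \<phi> (x n)) at_top sequentially"
proof -
  obtain C where C: "C > 0" "\<And>n. \<bar>u n\<bar> \<le> C"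
    using convergent_imp_bounded[OF u] unfolding bounded_pos by auto
  show ?thesis
  proof (rule filterlim_at_top_mono)
    show "filterlim (\<lambda>n. x n - C * \<phi> (x n)) at_top sequentially"
      by (rule filterlim_compose[OF self_neglecting_minus_at_top[OF sn C(1)] x])
    have "x n - C * \<phi> (x n) \<le> x n + u n * \<phi> (x n)" for n
      using mult_right_mono[of "- C" "u n" "\<phi> (x n)"] C(2)[of n] self_neglecting_pos[OF sn, of "x n"]
      by (simp add: abs_le_iff)
    then show "\<forall>\<^sub>F n in sequentially. x n - C * \<phi> (x n) \<le> x n + u n * \<phi> (x n)"
      by simp
  qed
qed

text \<open>Uniformity on \<open>[-C, C]\<close> absorbs the dependence of \<open>u\<close> on
  \<open>n\<close>. The ratio is the slope of the affine map that converts shifts from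
  \<open>x n\<close> into shifts from the new base point.\<close>

lemma self_neglecting_ratio_tendsto:
  assumes sn: "self_neglecting \<phi>"
    and x: "filterlim x at_top sequentially" and u: "u \<longlonglongrightarrow> (l :: real)"
  shows "(\<lambda>n. \<phi> (x n) / \<phi> (x n + u n * \<phi> (x n))) \<longlonglongrightarrow> 1"
proof -
  obtain C where C: "\<And>n. \<bar>u n\<bar> \<le> C"
    using convergent_imp_bounded[OF u] unfolding bounded_pos by auto
  have "(\<lambda>n. \<phi> (x n + u n * \<phi> (x n)) / \<phi> (x n)) \<longlonglongrightarrow> 1"
  proof (rule tendstoI)
    fix e :: real assume "e > 0"
    from self_neglecting_eventually[OF sn this, of C] x
    have "\<forall>\<^sub>F n in sequentially. \<forall>t. \<bar>t\<bar> \<le> C \<longrightarrow> \<bar>\<phi> (x n + t * \<phi> (x n)) / \<phi> (x n) - 1\<bar> < e"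
      by (rule eventually_compose_filterlim)
    then show "\<forall>\<^sub>F n in sequentially. dist (\<phi> (x n + u n * \<phi> (x n)) / \<phi> (x n)) 1 < e"
      by eventually_elim (use C in \<open>simp add: dist_real_def\<close>)
  qed
  from tendsto_inverse[OF this] show ?thesis by simp
qed

section \<open>Ideals with the Steinhaus property\<close>

text \<open>\<open>M\<close> only serves as a \<open>\<sigma>\<close>-algebra, so that category and measure can be treated alike.\<close>

locale steinhaus_ideal =
  fixes M :: "real measure" and negl :: "real set \<Rightarrow> bool"
  assumes space_UNIV [simp]: "space M = UNIV"
    and affine_measurable: "\<And>a b. a \<noteq> 0 \<Longrightarrow> (\<lambda>t. a * t + b) \<in> M \<rightarrow>\<^sub>M M"
    and negl_subset: "\<And>A B. negl B \<Longrightarrow> A \<subseteq> B \<Longrightarrow> negl A"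
    and negl_UN: "\<And>A :: nat \<Rightarrow> real set. (\<And>i. negl (A i)) \<Longrightarrow> negl (\<Union>i. A i)"
    and steinhaus: "\<And>A a b. A \<in> sets M \<Longrightarrow> \<not> negl A \<Longrightarrow> a \<longlonglongrightarrow> 1 \<Longrightarrow> b \<longlonglongrightarrow> 0 \<Longrightarrow>
                      \<forall>\<^sub>F n in sequentially. \<exists>t\<in>A. a n * t + b n \<in> A"
begin

text \<open>This is the case of vanishing shifts, where the Steinhaus property enters. Logarithms
  turn quotients into differences, so that the errors add up.\<close>

lemma shift_tendsto_0:
  fixes \<phi> f g :: "real \<Rightarrow> real"
  assumes sn: "self_neglecting \<phi>" and f_pos: "\<And>x. 0 < f x"
    and lim: "\<And>t. ((\<lambda>x. f (x + t * \<phi> x) / f x) \<longlongrightarrow> g t) at_top"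
    and f: "f \<in> borel_measurable M" and S: "\<not> negl S" "\<And>t. t \<in> S \<Longrightarrow> 0 < g t"
    and x: "filterlim x at_top sequentially" and u: "u \<longlonglongrightarrow> 0"
  shows "(\<lambda>n. ln (f (x n + u n * \<phi> (x n))) - ln (f (x n))) \<longlonglongrightarrow> 0"
proof (rule tendstoI)
  fix e :: real assume "e > 0"
  \<comment> \<open>Four errors of size at most \<open>d\<close> occur: \<open>H\<close> against
    \<open>k\<close>, and \<open>k\<close> against a common grid point, each at both
    \<open>s\<close> and \<open>t\<close>. The fifth share makes the final inequality
    strict.\<close>
  define d where "d = e / 5"
  have "d > 0" using \<open>e > 0\<close> by (simp add: d_def)
  define y where "y n = x n + u n * \<phi> (x n)" for n
  define c where "c n = \<phi> (x n) / \<phi> (y n)" for n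
  define H where "H z t = ln (f (z + t * \<phi> z)) - ln (f z)" for z t
  define k where "k t = ln (g t)" for t
  have \<phi>_pos: "\<phi> z > 0" for z by (rule self_neglecting_pos[OF sn])
  have y: "filterlim y at_top sequentially"
    using self_neglecting_shift_at_top[OF sn x u] by (simp add: y_def[abs_def])
  have c: "c \<longlonglongrightarrow> 1"
    using self_neglecting_ratio_tendsto[OF sn x u] by (simp add: c_def[abs_def] y_def)

  have H_lim: "(\<lambda>n. H (z n) t) \<longlonglongrightarrow> k t"
    if z: "filterlim z at_top sequentially" and "g t > 0" for z t
  proof -
    have "(\<lambda>n. ln (f (z n + t * \<phi> (z n)) / f (z n))) \<longlonglongrightarrow> ln (g t)"
      using \<open>g t > 0\<close> by (intro tendsto_ln filterlim_compose[OF lim z]) auto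
    then show ?thesis
      by (simp add: H_def k_def ln_div f_pos less_imp_neq[OF f_pos, symmetric])
  qed
  have f_affine [measurable]: "(\<lambda>t. f (z + t * \<phi> z)) \<in> borel_measurable M" for z
    using measurable_comp[OF affine_measurable[of "\<phi> z" z] f] \<phi>_pos[of z]
    by (simp add: o_def ac_simps)
  have [measurable]: "H z \<in> borel_measurable M" for z
    unfolding H_def[abs_def] by measurable
  have [measurable]: "g \<in> borel_measurable M"
  proof (rule borel_measurable_LIMSEQ_real)
    show "(\<lambda>n. f (real n + t * \<phi> (real n)) / f (real n)) \<longlonglongrightarrow> g t" for t
      by (rule filterlim_compose[OF lim filterlim_real_sequentially])
  qed measurable
  have [measurable]: "k \<in> borel_measurable M"
    unfolding k_def[abs_def] by measurable

  \<comment> \<open>In \<open>p\<close>, the integer selects a point of the grid of mesh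
    \<open>d\<close> near \<open>k t\<close>, and the natural number is an index from which both
    convergences are within \<open>d\<close>. The index type is countable.\<close>
  define E :: "int \<times> nat \<Rightarrow> real set" where
    "E p = {t \<in> space M. 0 < g t \<and> (\<forall>m\<ge>snd p. \<bar>H (x m) t - k t\<bar> \<le> d \<and> \<bar>H (y m) t - k t\<bar> \<le> d)
              \<and> \<bar>k t - of_int (fst p) * d\<bar> \<le> d}" for p
  have E_meas: "E p \<in> sets M" for p
    unfolding E_def by measurable
  have cover: "{t. 0 < g t} \<subseteq> (\<Union>i. E (from_nat i))"
  proof
    fix t assume "t \<in> {t. 0 < g t}"
    then have t: "0 < g t" by simp
    have "\<forall>\<^sub>F m in sequentially. \<bar>H (x m) t - k t\<bar> < d"
      using tendstoD[OF H_lim[OF x t] \<open>d > 0\<close>] by (simp add: dist_real_def)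
    moreover have "\<forall>\<^sub>F m in sequentially. \<bar>H (y m) t - k t\<bar> < d"
      using tendstoD[OF H_lim[OF y t] \<open>d > 0\<close>] by (simp add: dist_real_def)
    ultimately have "\<forall>\<^sub>F m in sequentially. \<bar>H (x m) t - k t\<bar> \<le> d \<and> \<bar>H (y m) t - k t\<bar> \<le> d"
      by eventually_elim auto
    then obtain n where n: "\<And>m. m \<ge> n \<Longrightarrow> \<bar>H (x m) t - k t\<bar> \<le> d \<and> \<bar>H (y m) t - k t\<bar> \<le> d"
      unfolding eventually_sequentially by blast
    define j where "j = \<lfloor>k t / d\<rfloor>"
    have "of_int j \<le> k t / d" "k t / d < of_int j + 1"
      by (simp_all add: j_def)
    then have "\<bar>k t - of_int j * d\<bar> \<le> d"
      using \<open>d > 0\<close> by (simp add: field_simps abs_if)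
    with n t have "t \<in> E (j, n)" by (simp add: E_def)
    then show "t \<in> (\<Union>i. E (from_nat i))"
      by (metis UN_I UNIV_I from_nat_to_nat)
  qed
  \<comment> \<open>\<open>S\<close> may be non-measurable, whereas the sets \<open>E p\<close> that
    cover it are measurable, as the Steinhaus property requires.\<close>
  have "\<exists>p. \<not> negl (E p)"
  proof (rule ccontr)
    assume "\<nexists>p. \<not> negl (E p)"
    then have "negl (\<Union>i. E (from_nat i))"
      by (intro negl_UN) blast
    moreover have "S \<subseteq> (\<Union>i. E (from_nat i))"
      using S(2) cover by blast
    ultimately have "negl S" by (rule negl_subset)
    with S(1) show False by contradiction
  qed
  then obtain p where p: "\<not> negl (E p)" by blast
  \<comment> \<open>This is the constant term of the base point change
    \<open>s = c n * (t - u n)\<close>.\<close>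
  have "(\<lambda>n. - (u n * c n)) \<longlonglongrightarrow> - (0 * 1)"
    by (intro tendsto_intros u c)
  then have "\<forall>\<^sub>F n in sequentially. \<exists>t\<in>E p. c n * t + - (u n * c n) \<in> E p"
    by (intro steinhaus E_meas p c) simp
  with eventually_ge_at_top[of "snd p"]
  show "\<forall>\<^sub>F n in sequentially. dist (ln (f (x n + u n * \<phi> (x n))) - ln (f (x n))) 0 < e"
  proof eventually_elim
    case (elim n)
    then obtain t where t: "t \<in> E p" "c n * t + - (u n * c n) \<in> E p" by blast
    define s where "s = c n * t + - (u n * c n)"
    have "s * \<phi> (y n) = (t - u n) * \<phi> (x n)"
      using \<phi>_pos[of "y n"] by (simp add: s_def c_def field_simps)
    then have "y n + s * \<phi> (y n) = x n + t * \<phi> (x n)"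
      by (simp add: y_def algebra_simps)
    then have "ln (f (y n)) - ln (f (x n)) = H (x n) t - H (y n) s"
      by (simp add: H_def)
    moreover have "\<bar>H (x n) t - k t\<bar> \<le> d" "\<bar>k t - of_int (fst p) * d\<bar> \<le> d"
      using t(1) elim(1) by (auto simp: E_def)
    moreover have "\<bar>H (y n) s - k s\<bar> \<le> d" "\<bar>k s - of_int (fst p) * d\<bar> \<le> d"
      using t(2) elim(1) by (auto simp: E_def s_def)
    ultimately have "\<bar>ln (f (y n)) - ln (f (x n))\<bar> \<le> 4 * d" by linarith
    also have "\<dots> < e" using \<open>e > 0\<close> by (simp add: d_def)
    finally show ?case by (simp add: y_def dist_real_def)
  qed
qed

text \<open>The quotient is factored through the base point \<open>z n\<close>, which is
  \<open>x n\<close> shifted by the limit \<open>l\<close>. Logarithms are used for the factor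
  tending to 1 only, since \<open>g l\<close> is not known to be positive.\<close>

lemma continuous_convergence:
  fixes \<phi> f g :: "real \<Rightarrow> real"
  assumes sn: "self_neglecting \<phi>" and f_pos: "\<And>x. 0 < f x"
    and lim: "\<And>t. ((\<lambda>x. f (x + t * \<phi> x) / f x) \<longlongrightarrow> g t) at_top"
    and f: "f \<in> borel_measurable M" and S: "\<not> negl S" "\<And>t. t \<in> S \<Longrightarrow> 0 < g t"
    and x: "filterlim x at_top sequentially" and u: "u \<longlonglongrightarrow> l"
  shows "(\<lambda>n. f (x n + u n * \<phi> (x n)) / f (x n)) \<longlonglongrightarrow> g l"
proof -
  have \<phi>_pos: "\<phi> z > 0" for z by (rule self_neglecting_pos[OF sn])
  define z where "z n = x n + l * \<phi> (x n)" for n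
  \<comment> \<open>The remaining shift \<open>u n - l\<close>, rescaled from units of
    \<open>\<phi> (x n)\<close> to units of \<open>\<phi> (z n)\<close>.\<close>
  define v where "v n = (u n - l) * (\<phi> (x n) / \<phi> (z n))" for n
  have z: "filterlim z at_top sequentially"
    using self_neglecting_shift_at_top[OF sn x tendsto_const[of l]] by (simp add: z_def[abs_def])
  have "v \<longlonglongrightarrow> (l - l) * 1"
    unfolding v_def[abs_def] z_def
    by (intro tendsto_intros u self_neglecting_ratio_tendsto[OF sn x tendsto_const])
  then have "v \<longlonglongrightarrow> 0" by simp
  from tendsto_exp[OF shift_tendsto_0[OF sn f_pos lim f S z this]]
  have "(\<lambda>n. f (z n + v n * \<phi> (z n)) / f (z n)) \<longlonglongrightarrow> 1"
    by (simp add: exp_diff f_pos)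
  from tendsto_mult[OF this filterlim_compose[OF lim[of l] x]]
  have "(\<lambda>n. f (z n + v n * \<phi> (z n)) / f (z n) * (f (z n) / f (x n))) \<longlonglongrightarrow> g l"
    by (simp add: z_def)
  moreover have "z n + v n * \<phi> (z n) = x n + u n * \<phi> (x n)" for n
    using \<phi>_pos[of "z n"] by (simp add: v_def) (simp add: z_def algebra_simps)
  moreover have "f (z n) \<noteq> 0" for n
    using f_pos[of "z n"] by simp
  ultimately show ?thesis by simp
qed

lemma locally_uniform:
  fixes \<phi> f g :: "real \<Rightarrow> real"
  assumes "self_neglecting \<phi>" and "\<And>x. 0 < f x"
    and "\<And>t. ((\<lambda>x. f (x + t * \<phi> x) / f x) \<longlongrightarrow> g t) at_top"
    and "f \<in> borel_measurable M" and "\<not> negl S" and "\<And>t. t \<in> S \<Longrightarrow> 0 < g t"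
  shows "locally_uniform_limit (\<lambda>x t. f (x + t * \<phi> x) / f x) g at_top"
  by (rule locally_uniform_limit_sequentiallyI) (rule continuous_convergence[OF assms])

end

section \<open>Lebesgue null sets\<close>

text \<open>Inner regularity: some bounded piece of \<open>A\<close> is not null, and a closed
  subset that loses less than the measure of this piece is compact and has positive measure.\<close>

lemma lebesgue_compact_subset:
  fixes A :: "'a::euclidean_space set"
  assumes A: "A \<in> sets lebesgue" "A \<notin> null_sets lebesgue"
  obtains K where "compact K" "K \<subseteq> A" "0 < emeasure lebesgue K"
proof -
  have "\<exists>n::nat. A \<inter> cball 0 (real n) \<notin> null_sets lebesgue"
  proof (rule ccontr)
    assume "\<not> ?thesis"
    then have "(\<Union>n::nat. A \<inter> cball 0 (real n)) \<in> null_sets lebesgue"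
      by (intro null_sets_UN) auto
    moreover have "(\<Union>n::nat. A \<inter> cball 0 (real n)) = A"
      using real_arch_simple by auto
    ultimately show False using A by simp
  qed
  then obtain n :: nat where n: "A \<inter> cball 0 (real n) \<notin> null_sets lebesgue" by blast
  define S where "S = A \<inter> cball 0 (real n)"
  have S: "S \<in> sets lebesgue"
    unfolding S_def by (intro sets.Int A(1) fmeasurableD lmeasurable_cball)
  then have "emeasure lebesgue S > 0"
    using n by (auto simp: S_def null_sets_def zero_less_iff_neq_zero)
  then obtain d where d: "0 < d" "d < emeasure lebesgue S"
    using dense by blast
  define e where "e = enn2real d"
  have "d < top"
    using d(2) by (rule less_le_trans) simp
  then have e: "e > 0" "ennreal e < emeasure lebesgue S"
    using d by (simp_all add: e_def enn2real_positive_iff)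
  obtain T where T: "closed T" "T \<subseteq> S" "S - T \<in> lmeasurable" "emeasure lebesgue (S - T) < ennreal e"
    using sets_lebesgue_inner_closed[OF S e(1)] .
  have "compact T"
    using T bounded_subset[of "cball 0 (real n)" T] by (auto simp: compact_eq_bounded_closed S_def)
  moreover have "T \<subseteq> A" using T by (auto simp: S_def)
  moreover have "0 < emeasure lebesgue T"
  proof (rule ccontr)
    assume "\<not> 0 < emeasure lebesgue T"
    then have 0: "emeasure lebesgue T = 0" by (simp add: zero_less_iff_neq_zero)
    have "emeasure lebesgue S = emeasure lebesgue (T \<union> (S - T))"
      using T by (simp add: Un_absorb1)
    also have "\<dots> \<le> emeasure lebesgue T + emeasure lebesgue (S - T)"
      using T by (intro emeasure_subadditive) (auto simp: fmeasurableD)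
    also have "\<dots> < ennreal e" using T 0 by simp
    finally show False using e by simp
  qed
  ultimately show ?thesis using that by blast
qed

text \<open>If the image of \<open>K\<close> missed \<open>K\<close>, it would lie in
  \<open>U - K\<close>, whose measure is below half that of \<open>K\<close>. But the image has
  measure \<open>a n\<close> times that of \<open>K\<close>, with \<open>a n > 1/2\<close>.\<close>

lemma steinhaus_lebesgue:
  fixes A :: "real set"
  assumes A: "A \<in> sets lebesgue" "A \<notin> null_sets lebesgue" and a: "a \<longlonglongrightarrow> 1" and b: "b \<longlonglongrightarrow> 0"
  shows "\<forall>\<^sub>F n in sequentially. \<exists>t\<in>A. a n * t + b n \<in> A"
proof -
  obtain K where K: "compact K" "K \<subseteq> A" "0 < emeasure lebesgue K"
    using lebesgue_compact_subset[OF A] .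
  have K_lm: "K \<in> lmeasurable" using K by (simp add: lmeasurable_compact)
  then have mK: "emeasure lebesgue K = ennreal (measure lebesgue K)"
    by (rule emeasure_eq_measure2)
  then have mK_pos: "measure lebesgue K > 0" using K(3) by (simp add: ennreal_less_zero_iff)
  obtain U where U: "open U" "K \<subseteq> U" "emeasure lebesgue (U - K) < ennreal (measure lebesgue K / 2)"
    using sets_lebesgue_outer_open[OF fmeasurableD[OF K_lm] half_gt_zero[OF mK_pos]] by blast
  obtain r where r: "r > 0" "(\<Union>t\<in>K. ball t r) \<subseteq> U"
    using compact_subset_open_imp_ball_epsilon_subset[OF K(1) U(1,2)] .
  obtain B where B: "\<And>t. t \<in> K \<Longrightarrow> \<bar>t\<bar> \<le> B"
    using compact_imp_bounded[OF K(1)] unfolding bounded_iff by auto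
  \<comment> \<open>This bounds the displacement of all points of \<open>K\<close> at once, so that
    the image of \<open>K\<close> stays inside \<open>U\<close>.\<close>
  have "(\<lambda>n. \<bar>a n - 1\<bar> * B + \<bar>b n\<bar>) \<longlonglongrightarrow> \<bar>1 - 1\<bar> * B + \<bar>0\<bar>"
    by (intro tendsto_intros a b)
  then have "\<forall>\<^sub>F n in sequentially. \<bar>a n - 1\<bar> * B + \<bar>b n\<bar> < r"
    using r by (intro order_tendstoD) auto
  moreover have "\<forall>\<^sub>F n in sequentially. a n > 1/2"
    using a by (rule order_tendstoD) simp
  ultimately show ?thesis
  proof eventually_elim
    case (elim n)
    show ?case
    proof (rule ccontr)
      assume none: "\<not> ?case"
      let ?T = "\<lambda>t. a n *\<^sub>R t + b n"
      have "?T ` K \<subseteq> U - K"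
      proof (intro image_subsetI DiffI)
        fix t assume t: "t \<in> K"
        have "\<bar>?T t - t\<bar> = \<bar>(a n - 1) * t + b n\<bar>" by (simp add: algebra_simps)
        also have "\<dots> \<le> \<bar>a n - 1\<bar> * \<bar>t\<bar> + \<bar>b n\<bar>"
          by (metis abs_mult abs_triangle_ineq)
        also have "\<dots> \<le> \<bar>a n - 1\<bar> * B + \<bar>b n\<bar>"
          using B[OF t] by (intro add_mono mult_left_mono) auto
        finally have "?T t \<in> ball t r" using elim(1) by (simp add: dist_real_def abs_minus_commute)
        then show "?T t \<in> U" using r t by blast
        show "?T t \<notin> K" using none t K(2) by auto
      qed
      then have "emeasure lebesgue (?T ` K) \<le> emeasure lebesgue (U - K)"
        using U(1) K_lm by (intro emeasure_mono) (auto simp: fmeasurableD)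
      moreover have "emeasure lebesgue (?T ` K) = ennreal (a n * measure lebesgue K)"
        using emeasure_lebesgue_affine[of "a n" "b n" K] elim(2) mK by (simp add: ennreal_mult)
      ultimately have "ennreal (a n * measure lebesgue K) < ennreal (measure lebesgue K / 2)"
        using U(3) by simp
      then have "a n * measure lebesgue K < 1/2 * measure lebesgue K"
        using mK_pos elim(2) by (subst (asm) ennreal_less_iff) auto
      with elim(2) mK_pos show False by simp
    qed
  qed
qed

text \<open>Subsets of null sets are null because Lebesgue measure is complete.\<close>

interpretation null: steinhaus_ideal lebesgue "\<lambda>A. A \<in> null_sets lebesgue"
proof
  show "(\<lambda>t. a * t + b) \<in> lebesgue \<rightarrow>\<^sub>M lebesgue" if "a \<noteq> 0" for a b :: real
    using lebesgue_affine_measurable[of "\<lambda>_. a" b] that by (simp add: add.commute mult.commute)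
qed (auto intro: null_sets_completion_subset steinhaus_lebesgue)

section \<open>Meagre sets\<close>

lemma nowhere_dense_subset: "nowhere_dense B \<Longrightarrow> A \<subseteq> B \<Longrightarrow> nowhere_dense A"
  unfolding nowhere_dense_def by (metis closure_mono interior_mono subset_empty)

lemma meagre_subset:
  assumes "meagre B" "A \<subseteq> B" shows "meagre A"
proof -
  obtain N :: "nat \<Rightarrow> 'a set" where "\<And>n. nowhere_dense (N n)" "B = (\<Union>n. N n)"
    using assms(1) unfolding meagre_def by auto
  with assms(2) show ?thesis
    unfolding meagre_def
    by (intro exI[of _ "\<lambda>n. N n \<inter> A"]) (auto intro: nowhere_dense_subset)
qed

lemma nowhere_dense_imp_meagre: "nowhere_dense A \<Longrightarrow> meagre A"
  unfolding meagre_def by (intro exI[of _ "\<lambda>_. A"]) auto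

lemma meagre_UN:
  fixes A :: "nat \<Rightarrow> 'a::topological_space set"
  assumes "\<And>i. meagre (A i)" shows "meagre (\<Union>i. A i)"
proof -
  have "\<forall>i. \<exists>N :: nat \<Rightarrow> 'a set. (\<forall>n. nowhere_dense (N n)) \<and> A i = (\<Union>n. N n)"
    using assms by (simp add: meagre_def)
  then obtain N :: "nat \<Rightarrow> nat \<Rightarrow> 'a set"
    where N: "\<And>i n. nowhere_dense (N i n)" "\<And>i. A i = (\<Union>n. N i n)"
    by metis
  have "(\<Union>i. A i) = (\<Union>j. N (fst (prod_decode j)) (snd (prod_decode j)))"
  proof (intro equalityI subsetI)
    fix x assume "x \<in> (\<Union>i. A i)"
    then obtain i n where "x \<in> N i n" using N(2) by auto
    then show "x \<in> (\<Union>j. N (fst (prod_decode j)) (snd (prod_decode j)))"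
      by (intro UN_I[of "prod_encode (i, n)"]) auto
  qed (auto simp: N(2))
  then show ?thesis
    unfolding meagre_def using N(1)
    by (intro exI[of _ "\<lambda>j. N (fst (prod_decode j)) (snd (prod_decode j))"]) auto
qed

lemma meagre_Un:
  assumes "meagre A" "meagre B" shows "meagre (A \<union> B)"
proof -
  have "meagre (\<Union>i::nat. if i = 0 then A else B)"
    using assms by (intro meagre_UN) auto
  then show ?thesis
    by (rule meagre_subset) (auto intro: exI[of _ 0] exI[of _ 1])
qed

text \<open>Baire category: the complements of the closures of the \<open>N n\<close> are open and
  dense, so their intersection is dense, yet it misses the open set \<open>U\<close>.\<close>

lemma meagre_open_empty:
  fixes U :: "'a::{real_normed_vector,heine_borel} set"
  assumes U: "open U" and "meagre U" shows "U = {}"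
proof -
  obtain N :: "nat \<Rightarrow> 'a set" where N: "\<And>n. nowhere_dense (N n)" "U = (\<Union>n. N n)"
    using \<open>meagre U\<close> unfolding meagre_def by auto
  define G where "G = range (\<lambda>n. - closure (N n))"
  have "UNIV \<subseteq> closure (\<Inter>G)"
  proof (rule Baire)
    show "openin (top_of_set UNIV) T \<and> UNIV \<subseteq> closure T" if "T \<in> G" for T
      using that N(1) by (auto simp: G_def closure_complement nowhere_dense_def)
  qed (auto simp: G_def)
  moreover have "U \<inter> \<Inter>G = {}"
    using closure_subset N(2) by (fastforce simp: G_def)
  ultimately show ?thesis
    using open_Int_closure_eq_empty[OF U, of "\<Inter>G"] by auto
qed

lemma meagre_vimage_homeomorphism:
  assumes h: "homeomorphism UNIV UNIV h h'" and "meagre A" shows "meagre (h -` A)"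
proof -
  have cont: "continuous_on UNIV h" "continuous_on UNIV h'" and inv: "\<And>x. h' (h x) = x" "\<And>x. h (h' x) = x"
    using h by (auto simp: homeomorphism_def)
  have "nowhere_dense (h -` N)" if "nowhere_dense N" for N
  proof -
    have "closure (h -` N) \<subseteq> h -` closure N"
      using cont(1) closure_subset by (intro closure_minimal) (auto intro: closed_vimage)
    then have "h' -` interior (closure (h -` N)) \<subseteq> closure N"
      using interior_subset[of "closure (h -` N)"] inv(2) by force
    moreover have "open (h' -` interior (closure (h -` N)))"
      using cont(2) by (intro open_vimage) auto
    ultimately have "h' -` interior (closure (h -` N)) \<subseteq> interior (closure N)"
      by (rule interior_maximal)
    then show ?thesis
      using that inv(1) unfolding nowhere_dense_def by (metis subset_empty subset_iff vimageI empty_iff equals0I)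
  qed
  moreover obtain N :: "nat \<Rightarrow> _ set" where "\<And>n. nowhere_dense (N n)" "A = (\<Union>n. N n)"
    using \<open>meagre A\<close> unfolding meagre_def by auto
  ultimately show ?thesis
    unfolding meagre_def by (intro exI[of _ "\<lambda>n. h -` N n"]) auto
qed

lemma homeomorphism_affine:
  fixes a b :: real
  assumes "a \<noteq> 0" shows "homeomorphism UNIV UNIV (\<lambda>t. a * t + b) (\<lambda>t. (t - b) / a)"
  using assms by (intro homeomorphismI) (auto intro!: continuous_intros)

section \<open>The sigma-algebra of sets with the Baire property\<close>

lemma baire_property_set_Compl:
  assumes "baire_property_set A" shows "baire_property_set (- A)"
proof -
  obtain U where U: "open U" "meagre ((A - U) \<union> (U - A))"
    using assms unfolding baire_property_set_def by auto
  \<comment> \<open>The complement of \<open>A\<close> is approximated by the exterior of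
    \<open>U\<close>. The additional error is the boundary of \<open>U\<close>, which is closed with
    empty interior.\<close>
  have "closure (closure U - U) = closure U - U"
    using U(1) by (simp add: closed_Diff)
  moreover have "interior (closure U - U) = {}"
    using interior_subset[of "closure U"] by (auto simp: interior_diff)
  ultimately have "nowhere_dense (closure U - U)"
    by (simp add: nowhere_dense_def)
  from meagre_Un[OF U(2) nowhere_dense_imp_meagre[OF this]]
  have "meagre ((- A - - closure U) \<union> (- closure U - - A))"
    by (rule meagre_subset) (use closure_subset[of U] in auto)
  then show ?thesis
    unfolding baire_property_set_def by (intro exI[of _ "- closure U"]) auto
qed

lemma baire_property_set_UN:
  fixes A :: "nat \<Rightarrow> 'a::topological_space set"
  assumes "\<And>i. baire_property_set (A i)" shows "baire_property_set (\<Union>i. A i)"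
proof -
  obtain U where U: "\<And>i. open (U i)" "\<And>i. meagre ((A i - U i) \<union> (U i - A i))"
    using assms unfolding baire_property_set_def by metis
  have "meagre (\<Union>i. (A i - U i) \<union> (U i - A i))"
    by (intro meagre_UN U)
  then have "meagre (((\<Union>i. A i) - (\<Union>i. U i)) \<union> ((\<Union>i. U i) - (\<Union>i. A i)))"
    by (rule meagre_subset) auto
  then show ?thesis
    unfolding baire_property_set_def using U(1) by (intro exI[of _ "\<Union>i. U i"]) auto
qed

lemma sigma_algebra_baire_property:
  "sigma_algebra UNIV {A :: 'a::topological_space set. baire_property_set A}"
proof -
  have "meagre ({} :: 'a set)"
    by (rule nowhere_dense_imp_meagre) (simp add: nowhere_dense_def)
  then have "baire_property_set ({} :: 'a set)"
    unfolding baire_property_set_def by (intro exI[of _ "{}"]) auto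
  then show ?thesis
    unfolding sigma_algebra_iff2
    by (auto simp: Compl_eq_Diff_UNIV[symmetric] intro: baire_property_set_Compl baire_property_set_UN)
qed

text \<open>Packaged as a \<open>measure\<close> so that measurability results apply to functions
  with the Baire property.\<close>

definition baire_algebra :: "'a::topological_space measure" where
  "baire_algebra = sigma UNIV {A. baire_property_set A}"

lemma space_baire_algebra [simp]: "space baire_algebra = UNIV"
  by (simp add: baire_algebra_def)

lemma sets_baire_algebra: "sets baire_algebra = {A. baire_property_set A}"
  by (simp add: baire_algebra_def sigma_algebra.sigma_sets_eq[OF sigma_algebra_baire_property])

lemma baire_property_fun_measurable: "baire_property_fun f \<Longrightarrow> f \<in> borel_measurable baire_algebra"
  by (intro borel_measurableI) (simp add: baire_property_fun_def sets_baire_algebra)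

text \<open>Modulo a meagre set, \<open>A\<close> is a nonempty open \<open>U\<close>. For large
  \<open>n\<close> the set \<open>U\<close> and its affine preimage share the point
  \<open>t0\<close>, and their open intersection is too large to be meagre.\<close>

lemma steinhaus_meagre:
  fixes A :: "real set"
  assumes A: "baire_property_set A" "\<not> meagre A" and a: "a \<longlonglongrightarrow> 1" and b: "b \<longlonglongrightarrow> 0"
  shows "\<forall>\<^sub>F n in sequentially. \<exists>t\<in>A. a n * t + b n \<in> A"
proof -
  obtain U where U: "open U" "meagre ((A - U) \<union> (U - A))"
    using A unfolding baire_property_set_def by auto
  have "U \<noteq> {}" using U(2) A(2) by auto
  then obtain t0 where t0: "t0 \<in> U" by blast
  have UA: "meagre (U - A)" using U(2) by (rule meagre_subset) auto
  have "(\<lambda>n. a n * t0 + b n) \<longlonglongrightarrow> 1 * t0 + 0"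
    by (intro tendsto_intros a b)
  then have "\<forall>\<^sub>F n in sequentially. a n * t0 + b n \<in> U"
    using U(1) t0 by (intro topological_tendstoD) auto
  moreover have "\<forall>\<^sub>F n in sequentially. a n > 0"
    using a by (rule order_tendstoD) simp
  ultimately show ?thesis
  proof eventually_elim
    case (elim n)
    let ?T = "\<lambda>t. a n * t + b n"
    have T: "homeomorphism UNIV UNIV ?T (\<lambda>t. (t - b n) / a n)"
      using elim(2) by (intro homeomorphism_affine) simp
    show ?case
    proof (rule ccontr)
      assume "\<not> ?case"
      \<comment> \<open>Under the contrary assumption, every point of the overlap lies outside
        \<open>A\<close> or has its image outside \<open>A\<close>.\<close>
      then have sub: "U \<inter> ?T -` U \<subseteq> (U - A) \<union> ?T -` (U - A)" by auto
      have "meagre (U \<inter> ?T -` U)"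
        by (rule meagre_subset[OF meagre_Un[OF UA meagre_vimage_homeomorphism[OF T UA]] sub])
      moreover have "open (U \<inter> ?T -` U)"
        using U(1) by (intro open_Int open_vimage) (auto intro!: continuous_intros)
      ultimately have "U \<inter> ?T -` U = {}" by (intro meagre_open_empty)
      with t0 elim(1) show False by auto
    qed
  qed
qed

text \<open>A nondegenerate affine map is a homeomorphism, so it pulls back both the open
  approximant and the meagre error.\<close>

interpretation meagre: steinhaus_ideal baire_algebra meagre
proof
  show "(\<lambda>t. a * t + b) \<in> baire_algebra \<rightarrow>\<^sub>M baire_algebra" if "a \<noteq> 0" for a b :: real
  proof (rule measurableI)
    let ?T = "\<lambda>t. a * t + b"
    fix A :: "real set" assume "A \<in> sets baire_algebra"
    then obtain U where U: "open U" "meagre ((A - U) \<union> (U - A))"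
      by (auto simp: sets_baire_algebra baire_property_set_def)
    have "meagre ((?T -` A - ?T -` U) \<union> (?T -` U - ?T -` A))"
      using meagre_vimage_homeomorphism[OF homeomorphism_affine[OF that] U(2)] by (simp add: vimage_Un vimage_Diff)
    moreover have "open (?T -` U)"
      using U(1) by (intro open_vimage) (auto intro!: continuous_intros)
    ultimately show "?T -` A \<inter> space baire_algebra \<in> sets baire_algebra"
      by (auto simp: sets_baire_algebra baire_property_set_def)
  qed simp
qed (auto simp: sets_baire_algebra intro: meagre_subset meagre_UN steinhaus_meagre)

theorem theorem2:
  fixes \<phi> f g :: "real \<Rightarrow> real"
  assumes "self_neglecting \<phi>"
    and "\<And>x. 0 < f x"
    and "\<And>t. ((\<lambda>x. f (x + t * \<phi> x) / f x) \<longlongrightarrow> g t) at_top"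
    and "(baire_property_fun f \<and> (\<exists>S. \<not> meagre S \<and> (\<forall>t\<in>S. 0 < g t))) \<or>
         (f \<in> borel_measurable lebesgue \<and> (\<exists>S. S \<notin> null_sets lebesgue \<and> (\<forall>t\<in>S. 0 < g t)))"
  shows "locally_uniform_limit (\<lambda>x t. f (x + t * \<phi> x) / f x) g at_top"
  \<comment> \<open>Category and measure are two instances of one argument; in each case
    \<open>S\<close> is non-negligible for the ideal that matches the regularity of
    \<open>f\<close>.\<close>
  using assms(4)
proof (elim disjE conjE exE)
  fix S assume "baire_property_fun f" "\<not> meagre S" "\<forall>t\<in>S. 0 < g t"
  then show ?thesis
    by (intro meagre.locally_uniform[OF assms(1-3)] baire_property_fun_measurable) auto
next
  fix S assume "f \<in> borel_measurable lebesgue" "S \<notin> null_sets lebesgue" "\<forall>t\<in>S. 0 < g t"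
  then show ?thesis
    by (intro null.locally_uniform[OF assms(1-3)]) auto
qed

end
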